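(* The topological group $\mathrm{Homeo}_{+}(I)$, where $I=[0,1]$, does not satisfy the Stability of the Generators Property.
   Context: $\mathrm{Homeo}_{+}(I)$ is the group of orientation preserving homeomorphisms of $I=[0,1]$, with the topology given by its natural $C_0$ metric $d_0(f,g)=\max_{x\in[0,1]}|f(x)-g(x)|$. A topological group $G$ satisfies the Stability of the Generators Property (SGP) if for any finitely generated dense subgroup $\Gamma$ of $G$ generated by elements $g_1,\ldots,g_n$, there exists an open non-empty neighborhood $U$ of the identity such that if $h_i\in g_iU$ for $1\le i\le n$, then the group generated by $h_1,\ldots,h_n$ is also dense in $G$. *)

theory Defs
  imports "HOL-Analysis.Analysis" "HOL-Algebra.Algebra"
begin

locale topological_group = group G for G (structure) +
  fixes T :: "'a topology"
  assumes topspace_eq_carrier: "topspace T = carrier G"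
    and continuous_mult: "continuous_map (prod_topology T T) T (\<lambda>(x, y). x \<otimes> y)"
    and continuous_inv: "continuous_map T T (\<lambda>x. inv x)"

text \<open>The generators are the tuple \<open>g 1, \<dots>, g n\<close>; repetitions are allowed.\<close>

definition (in topological_group) SGP :: bool
  where "SGP \<longleftrightarrow>
    (\<forall>\<Gamma> (n::nat) (g :: nat \<Rightarrow> 'a).
       (\<forall>i\<in>{1..n}. g i \<in> carrier G) \<and>
       \<Gamma> = generate G (g ` {1..n}) \<and> T closure_of \<Gamma> = topspace T \<longrightarrow>
       (\<exists>U. openin T U \<and> \<one> \<in> U \<and>
          (\<forall>h :: nat \<Rightarrow> 'a. (\<forall>i\<in>{1..n}. h i \<in> g i <# U) \<longrightarrow>
             T closure_of generate G (h ` {1..n}) = topspace T)))"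

text \<open>Elements of \<open>Homeo\<^sub>+(I)\<close> are functions on the reals that are \<open>undefined\<close>
  outside \<open>[0, 1]\<close> (by \<open>Bij\<close>), so that equal homeomorphisms are equal functions.
  The product of \<open>f\<close> and \<open>g\<close> is \<open>f \<circ> g\<close>.\<close>

definition Homeo_plus_carrier :: "(real \<Rightarrow> real) set"
  where "Homeo_plus_carrier =
    {f \<in> Bij {0..1}. homeomorphic_map (top_of_set {0..1}) (top_of_set {0..1}) f \<and>
                     strict_mono_on {0..1} f}"

definition Homeo_plus :: "(real \<Rightarrow> real) monoid"
  where "Homeo_plus = (BijGroup {0..1})\<lparr>carrier := Homeo_plus_carrier\<rparr>"

text \<open>The library's sup metric on continuous functions, which is \<open>d\<^sub>0\<close>:
  see \<open>mdist_Homeo_plus\<close> and \<open>mdist_Homeo_plus_attained\<close> below.\<close>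

definition Homeo_plus_metric :: "(real \<Rightarrow> real) metric"
  where "Homeo_plus_metric =
    submetric (cfunspace (top_of_set {0..1}) euclidean_metric) Homeo_plus_carrier"

definition Homeo_plus_topology :: "(real \<Rightarrow> real) topology"
  where "Homeo_plus_topology = mtopology_of Homeo_plus_metric"


lemma Homeo_plus_carrierD:
  assumes "f \<in> Homeo_plus_carrier"
  shows "f \<in> Bij {0..1}" "continuous_on {0..1} f" "bij_betw f {0..1} {0..1}"
    "strict_mono_on {0..1} f" "f \<in> extensional {0..1}"
    "\<And>x. x \<in> {0..1} \<Longrightarrow> f x \<in> {0..1}"
proof -
  show *: "f \<in> Bij {0..1}" "strict_mono_on {0..1} f"
    using assms by (auto simp: Homeo_plus_carrier_def)
  then show b: "bij_betw f {0..1} {0..1}" "f \<in> extensional {0..1}"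
    by (auto simp: Bij_def)
  show "continuous_on {0..1} f"
    using assms homeomorphic_imp_continuous_map[of "top_of_set {0..1}" "top_of_set {0..1}" f]
    by (auto simp: Homeo_plus_carrier_def)
  show "\<And>x. x \<in> {0..1} \<Longrightarrow> f x \<in> {0..1}"
    using b bij_betwE by blast
qed

lemma Homeo_plus_carrierI:
  assumes b: "f \<in> Bij {0..1}" and c: "continuous_on {0..1} f" and m: "strict_mono_on {0..1} f"
  shows "f \<in> Homeo_plus_carrier"
proof -
  have "homeomorphic_map (top_of_set {0..1}) (top_of_set {0..1}) f"
  proof (rule continuous_imp_homeomorphic_map)
    show "continuous_map (top_of_set {0..1}) (top_of_set {0..1}) f"
      using b c by (auto simp: Bij_def bij_betw_def)
  qed (use b in \<open>auto simp: Bij_def bij_betw_def Hausdorff_space_subtopology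
      compact_space_subtopology compactin_euclidean_iff\<close>)
  then show ?thesis
    using b m by (simp add: Homeo_plus_carrier_def)
qed

lemma inverse_in_Homeo_plus_carrier:
  assumes f: "f \<in> Homeo_plus_carrier"
  shows "restrict (inv_into {0..1} f) {0..1} \<in> Homeo_plus_carrier"
proof (rule Homeo_plus_carrierI)
  note F = Homeo_plus_carrierD[OF f]
  show "restrict (inv_into {0..1} f) {0..1} \<in> Bij {0..1}"
    using F(1) restrict_inv_into_Bij by blast
  have "f ` {0..1} = {0..1}" "inj_on f {0..1}"
    using F(3) by (auto simp: bij_betw_def)
  then have "continuous_on {0..1} (inv_into {0..1} f)"
    using continuous_on_inv[of "{0..1}" f "inv_into {0..1} f"] F(2) by simp
  then show "continuous_on {0..1} (restrict (inv_into {0..1} f) {0..1})"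
    by (rule continuous_on_eq) simp
  have im: "f ` {0..1} = {0..1}"
    using F(3) by (auto simp: bij_betw_def)
  have "inv_into {0..1} f x < inv_into {0..1} f y"
    if "x \<in> {0..1}" "y \<in> {0..1}" "x < y" for x y
  proof (rule ccontr)
    let ?g = "inv_into {0..1} f"
    assume "\<not> ?g x < ?g y"
    moreover have "?g x \<in> {0..1}" "?g y \<in> {0..1}" "f (?g x) = x" "f (?g y) = y"
      using that im inv_into_into[of _ f "{0..1}"] f_inv_into_f[of _ f "{0..1}"] by metis+
    ultimately have "f (?g y) \<le> f (?g x)"
      using F(4) by (metis linorder_not_less order_less_le strict_mono_onD)
    then show False
      using \<open>f (?g x) = x\<close> \<open>f (?g y) = y\<close> that by simp
  qed
  then show "strict_mono_on {0..1} (restrict (inv_into {0..1} f) {0..1})"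
    by (simp add: strict_mono_on_def)
qed

lemma compose_in_Homeo_plus_carrier:
  assumes "f \<in> Homeo_plus_carrier" "g \<in> Homeo_plus_carrier"
  shows "compose {0..1} f g \<in> Homeo_plus_carrier"
proof (rule Homeo_plus_carrierI)
  note F = Homeo_plus_carrierD[OF assms(1)] and G = Homeo_plus_carrierD[OF assms(2)]
  show "compose {0..1} f g \<in> Bij {0..1}"
    using F G compose_Bij by blast
  have "continuous_on {0..1} (\<lambda>x. f (g x))"
    using G by (intro continuous_on_compose2[OF F(2)]) auto
  then show "continuous_on {0..1} (compose {0..1} f g)"
    by (rule continuous_on_eq) (simp add: compose_def)
  show "strict_mono_on {0..1} (compose {0..1} f g)"
    unfolding compose_def strict_mono_on_def
    using F(4) G(4) G(6) by (simp add: strict_mono_on_def)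
qed

lemma subgroup_Homeo_plus_carrier: "subgroup Homeo_plus_carrier (BijGroup {0..1})"
proof (rule group.subgroupI[OF group_BijGroup])
  show "Homeo_plus_carrier \<subseteq> carrier (BijGroup {0..1})"
    by (auto simp: Homeo_plus_carrier_def BijGroup_def)
  have "(\<lambda>x\<in>{0..1}. x) \<in> Homeo_plus_carrier"
    by (intro Homeo_plus_carrierI id_Bij continuous_on_eq[OF continuous_on_id])
       (auto simp: strict_mono_on_def)
  then show "Homeo_plus_carrier \<noteq> {}"
    by blast
next
  fix f assume "f \<in> Homeo_plus_carrier"
  then show "inv\<^bsub>BijGroup {0..1}\<^esub> f \<in> Homeo_plus_carrier"
    by (simp add: inv_BijGroup Homeo_plus_carrierD(1) inverse_in_Homeo_plus_carrier)
next
  fix f g assume "f \<in> Homeo_plus_carrier" "g \<in> Homeo_plus_carrier"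
  then show "f \<otimes>\<^bsub>BijGroup {0..1}\<^esub> g \<in> Homeo_plus_carrier"
    by (simp add: BijGroup_def Homeo_plus_carrierD(1) compose_in_Homeo_plus_carrier)
qed

lemma group_Homeo_plus: "group Homeo_plus"
  unfolding Homeo_plus_def
  by (rule subgroup.subgroup_is_group[OF subgroup_Homeo_plus_carrier group_BijGroup])

lemma carrier_Homeo_plus: "carrier Homeo_plus = Homeo_plus_carrier"
  by (simp add: Homeo_plus_def)

lemma one_Homeo_plus: "\<one>\<^bsub>Homeo_plus\<^esub> = (\<lambda>x\<in>{0..1}. x)"
  by (simp add: Homeo_plus_def BijGroup_def)

lemma mult_Homeo_plus:
  "f \<in> Homeo_plus_carrier \<Longrightarrow> g \<in> Homeo_plus_carrier \<Longrightarrow>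
    f \<otimes>\<^bsub>Homeo_plus\<^esub> g = compose {0..1} f g"
  by (simp add: Homeo_plus_def BijGroup_def Homeo_plus_carrierD(1))

lemma inv_Homeo_plus:
  "f \<in> Homeo_plus_carrier \<Longrightarrow> inv\<^bsub>Homeo_plus\<^esub> f = restrict (inv_into {0..1} f) {0..1}"
  unfolding Homeo_plus_def
  by (simp add: group.m_inv_consistent[OF group_BijGroup subgroup_Homeo_plus_carrier]
      inv_BijGroup Homeo_plus_carrierD(1))

lemma Homeo_plus_carrier_subset:
  "Homeo_plus_carrier \<subseteq> mspace (cfunspace (top_of_set {0..1}) euclidean_metric)"
proof
  fix f assume f: "f \<in> Homeo_plus_carrier"
  note F = Homeo_plus_carrierD[OF f]
  have "compact (f ` {0..1})"
    by (intro compact_continuous_image F) auto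
  then have "bounded (f ` {0..1})"
    by (rule compact_imp_bounded)
  then show "f \<in> mspace (cfunspace (top_of_set {0..1}) euclidean_metric)"
    using F by (simp add: Met_TC.fspace_def)
qed

lemma mspace_Homeo_plus: "mspace Homeo_plus_metric = Homeo_plus_carrier"
  using Homeo_plus_carrier_subset by (auto simp: Homeo_plus_metric_def)

lemma mdist_Homeo_plus:
  assumes "f \<in> Homeo_plus_carrier" "g \<in> Homeo_plus_carrier"
  shows "mdist Homeo_plus_metric f g = (SUP x\<in>{0..1}. \<bar>f x - g x\<bar>)"
proof -
  have "f \<in> Met_TC.fspace {0..1}" "g \<in> Met_TC.fspace {0..1}"
    using assms Homeo_plus_carrier_subset by (auto simp: Met_TC.fspace_def)
  then show ?thesis
    by (simp add: Homeo_plus_metric_def cfunspace_def Met_TC.fdist_def dist_real_def)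
qed

lemma mdist_Homeo_plus_attained:
  assumes "f \<in> Homeo_plus_carrier" "g \<in> Homeo_plus_carrier"
  shows "\<exists>x\<in>{0..1}. mdist Homeo_plus_metric f g = \<bar>f x - g x\<bar> \<and>
           (\<forall>y\<in>{0..1}. \<bar>f y - g y\<bar> \<le> \<bar>f x - g x\<bar>)"
proof -
  have "continuous_on {0..1} (\<lambda>x. \<bar>f x - g x\<bar>)"
    by (intro continuous_intros Homeo_plus_carrierD(2) assms)
  then obtain x where x: "x \<in> {0..1}" "\<forall>y\<in>{0..1}. \<bar>f y - g y\<bar> \<le> \<bar>f x - g x\<bar>"
    using continuous_attains_sup[of "{0..1::real}" "\<lambda>x. \<bar>f x - g x\<bar>"] by auto
  then have "(SUP x\<in>{0..1}. \<bar>f x - g x\<bar>) = \<bar>f x - g x\<bar>"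
    by (intro cSup_eq_maximum) auto
  then show ?thesis
    using x mdist_Homeo_plus[OF assms] by auto
qed

lemma mdist_Homeo_plus_less_iff:
  assumes "f \<in> Homeo_plus_carrier" "g \<in> Homeo_plus_carrier"
  shows "mdist Homeo_plus_metric f g < e \<longleftrightarrow> (\<forall>x\<in>{0..1}. \<bar>f x - g x\<bar> < e)"
  using mdist_Homeo_plus_attained[OF assms] by fastforce

lemma topspace_Homeo_plus: "topspace Homeo_plus_topology = Homeo_plus_carrier"
  by (simp add: Homeo_plus_topology_def mspace_Homeo_plus)

theorem topological_group_Homeo_plus: "topological_group Homeo_plus Homeo_plus_topology"
proof -
  let ?I = "{0..1::real}" and ?H = "Homeo_plus_carrier" and ?d = "mdist Homeo_plus_metric"
    and ?T = "Homeo_plus_topology"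
  interpret M: Metric_space ?H ?d
    using Metric_space_mspace_mdist[of Homeo_plus_metric] by (simp add: mspace_Homeo_plus)
  have T: "?T = M.mtopology"
    by (simp add: Homeo_plus_topology_def mtopology_of_def mspace_Homeo_plus)
  have unif: "\<exists>\<delta>>0. \<forall>x\<in>?I. \<forall>y\<in>?I. \<bar>x - y\<bar> < \<delta> \<longrightarrow> \<bar>f x - f y\<bar> < e"
    if "f \<in> ?H" "e > 0" for f and e :: real
  proof -
    have "uniformly_continuous_on ?I f"
      using that Homeo_plus_carrierD(2) by (intro compact_uniformly_continuous) auto
    then show ?thesis
      using that(2) unfolding uniformly_continuous_on_def dist_real_def by meson
  qed
  have mult: "continuous_map (prod_topology ?T ?T) ?T (\<lambda>(x, y). x \<otimes>\<^bsub>Homeo_plus\<^esub> y)"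
    unfolding T M.continuous_map_to_metric
  proof (intro ballI allI impI)
    fix p and e :: real
    assume p: "p \<in> topspace (prod_topology M.mtopology M.mtopology)" and e: "e > 0"
    obtain f g where fg: "p = (f, g)" "f \<in> ?H" "g \<in> ?H"
      using p by auto
    obtain \<delta> where \<delta>: "\<delta> > 0" "\<forall>x\<in>?I. \<forall>y\<in>?I. \<bar>x - y\<bar> < \<delta> \<longrightarrow> \<bar>f x - f y\<bar> < e/2"
      using unif[OF fg(2), of "e/2"] e by auto
    let ?U = "M.mball f (e/2) \<times> M.mball g \<delta>"
    have "(\<lambda>(x, y). x \<otimes>\<^bsub>Homeo_plus\<^esub> y) q \<in> M.mball ((\<lambda>(x, y). x \<otimes>\<^bsub>Homeo_plus\<^esub> y) p) e"
      if "q \<in> ?U" for q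
    proof -
      obtain f' g' where q: "q = (f', g')" "f' \<in> ?H" "g' \<in> ?H" "?d f f' < e/2" "?d g g' < \<delta>"
        using \<open>q \<in> ?U\<close> by auto
      have "\<bar>compose ?I f g x - compose ?I f' g' x\<bar> < e" if x: "x \<in> ?I" for x
      proof -
        have I: "g x \<in> ?I" "g' x \<in> ?I"
          using Homeo_plus_carrierD(6) fg q x by blast+
        have "\<bar>g x - g' x\<bar> < \<delta>"
          using q x mdist_Homeo_plus_less_iff[OF fg(3) q(3)] by blast
        then have "\<bar>f (g x) - f (g' x)\<bar> < e/2"
          using \<delta> I by blast
        moreover have "\<bar>f (g' x) - f' (g' x)\<bar> < e/2"
          using q I mdist_Homeo_plus_less_iff[OF fg(2) q(2)] by blast
        ultimately show ?thesis
          using x unfolding compose_def by simp argo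
      qed
      then show ?thesis
        using fg q by (simp add: mult_Homeo_plus compose_in_Homeo_plus_carrier
            mdist_Homeo_plus_less_iff)
    qed
    moreover have "openin (prod_topology M.mtopology M.mtopology) ?U"
      by (simp add: openin_prod_Times_iff)
    moreover have "p \<in> ?U"
      using fg e \<delta> by simp
    ultimately show "\<exists>U. openin (prod_topology M.mtopology M.mtopology) U \<and> p \<in> U \<and>
        (\<forall>q\<in>U. (\<lambda>(x, y). x \<otimes>\<^bsub>Homeo_plus\<^esub> y) q \<in> M.mball ((\<lambda>(x, y). x \<otimes>\<^bsub>Homeo_plus\<^esub> y) p) e)"
      by blast
  qed
  have inv: "continuous_map ?T ?T (\<lambda>x. inv\<^bsub>Homeo_plus\<^esub> x)"
    unfolding T M.continuous_map_to_metric
  proof (intro ballI allI impI)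
    fix f and e :: real
    assume "f \<in> topspace M.mtopology" and e: "e > 0"
    then have f: "f \<in> ?H" by simp
    let ?g = "\<lambda>f. restrict (inv_into ?I f) ?I"
    obtain \<delta> where \<delta>: "\<delta> > 0" "\<forall>x\<in>?I. \<forall>y\<in>?I. \<bar>x - y\<bar> < \<delta> \<longrightarrow> \<bar>?g f x - ?g f y\<bar> < e"
      using unif[OF inverse_in_Homeo_plus_carrier[OF f] e] by auto
    have "inv\<^bsub>Homeo_plus\<^esub> f' \<in> M.mball (inv\<^bsub>Homeo_plus\<^esub> f) e" if "f' \<in> M.mball f \<delta>" for f'
    proof -
      have f': "f' \<in> ?H" "?d f f' < \<delta>"
        using that by auto
      have "\<bar>?g f y - ?g f' y\<bar> < e" if y: "y \<in> ?I" for y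
      proof -
        define x where "x = inv_into ?I f' y"
        have x: "x \<in> ?I" "f' x = y"
          using Homeo_plus_carrierD(3)[OF f'(1)] y unfolding x_def
          by (metis bij_betw_def inv_into_into, metis bij_betw_def f_inv_into_f)
        have fx: "f x \<in> ?I" "inv_into ?I f (f x) = x"
          using Homeo_plus_carrierD(3,6)[OF f] x
          by (auto simp: bij_betw_def)
        have "\<bar>f x - y\<bar> < \<delta>"
          using mdist_Homeo_plus_less_iff[OF f f'(1)] f'(2) x by auto
        then have "\<bar>?g f y - ?g f (f x)\<bar> < e"
          using \<delta> fx y abs_minus_commute by metis
        then show ?thesis
          using fx y by (simp add: x_def)
      qed
      then have "?d (?g f) (?g f') < e"
        using inverse_in_Homeo_plus_carrier f f' by (simp add: mdist_Homeo_plus_less_iff)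
      then show ?thesis
        using inverse_in_Homeo_plus_carrier f f' by (simp add: inv_Homeo_plus)
    qed
    then show "\<exists>U. openin M.mtopology U \<and> f \<in> U \<and>
        (\<forall>f'\<in>U. inv\<^bsub>Homeo_plus\<^esub> f' \<in> M.mball (inv\<^bsub>Homeo_plus\<^esub> f) e)"
      using f \<delta>(1) by (intro exI[of _ "M.mball f \<delta>"]) simp
  qed
  show ?thesis
    by (intro topological_group.intro topological_group_axioms.intro group_Homeo_plus mult inv)
       (simp add: topspace_Homeo_plus carrier_Homeo_plus)
qed

end

theory Submission
  imports Defs
begin

text \<open>
  Two facts refute the Stability of the Generators Property.

  \<^item> No tuple of generators is stable. Fix \<open>\<delta> > 0\<close> and homeomorphisms \<open>g\<^sub>1, \<dots>, g\<^sub>n\<close>. All of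
    them fix \<open>0\<close>, so for a sufficiently small \<open>c > 0\<close> every point \<open>b\<^sub>i\<close> with \<open>g\<^sub>i b\<^sub>i = c\<close> lies
    below \<open>\<delta>\<close>, as does \<open>c\<close>. The piecewise linear map \<open>u\<^sub>i\<close> with its only break at \<open>(c, b\<^sub>i)\<close> is then
    \<open>\<delta>\<close>-close to the identity, and \<open>h\<^sub>i = g\<^sub>i \<circ> u\<^sub>i\<close> fixes \<open>c\<close>. The group generated by the \<open>h\<^sub>i\<close>
    fixes \<open>c\<close>, hence it is not dense (\<open>exists_perturbation_fixing_point\<close>,
    \<open>not_dense_if_common_fixed_point\<close>).

  \<^item> Some finitely generated subgroup is dense; without one the property would hold vacuously.
    Identify \<open>(0, 1)\<close> with the real line and let \<open>\<Gamma>\<close> be generated by \<open>x + 1\<close>, \<open>2 * x\<close> and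
    \<open>max x (2 * x)\<close>. The first two give all translations by dyadic rationals, and conjugating
    the third by these gives, for every dyadic \<open>s\<close>, a map that is the identity up to \<open>s\<close> and
    expands by \<open>2\<close> around \<open>s\<close> from there on. For \<open>p < x\<close> products of such maps
    with \<open>s \<ge> p\<close> and of their inverses fix everything up to \<open>p\<close> and carry \<open>x\<close> into any prescribed open interval above \<open>p\<close>
    (\<open>push_point_into_interval\<close>). Placing the points of a finite grid one after the other, from
    left to right, then approximates an arbitrary homeomorphism (\<open>dense_if_pushes_points\<close>).
\<close>

section \<open>Increasing bijections of the unit interval\<close>

text \<open>An increasing bijection has no jumps. Extending it by the identity to the real line makes
  its image open, which is what the library criterion for continuity of monotone maps asks for.\<close>

lemma strict_mono_Bij_in_Homeo_plus_carrier:
  assumes b: "f \<in> Bij {0..1}" and m: "strict_mono_on {0..1} f"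
  shows "f \<in> Homeo_plus_carrier"
proof (rule Homeo_plus_carrierI[OF b _ m])
  have bij: "bij_betw f {0..1} {0..1}"
    using b by (simp add: Bij_def)
  have fI: "f x \<in> {0..1}" if "x \<in> {0..1}" for x
    using bij that bij_betwE by blast
  define F where "F = (\<lambda>x. if x \<in> {0..1} then f x else x)"
  have "x \<in> range F" for x
  proof (cases "x \<in> {0..1}")
    case True
    then obtain y where "y \<in> {0..1}" "f y = x"
      using bij unfolding bij_betw_def by (metis imageE)
    then show ?thesis
      by (intro image_eqI[of _ _ y]) (simp_all add: F_def)
  next
    case False
    then show ?thesis
      by (intro image_eqI[of _ _ x]) (simp_all only: F_def if_False UNIV_I)
  qed
  then have "range F = UNIV"
    by blast
  moreover have "F x \<le> F y" if "x \<le> y" for x y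
    using that fI[of x] fI[of y] strict_mono_on_leD[OF m, of x y] by (auto simp: F_def)
  ultimately have "continuous_on UNIV F"
    by (intro continuous_onI_mono) auto
  then have "continuous_on {0..1} F"
    by (rule continuous_on_subset) simp
  then show "continuous_on {0..1} f"
    by (rule continuous_on_eq) (simp add: F_def)
qed

lemma Homeo_plus_carrier_mono:
  assumes "f \<in> Homeo_plus_carrier" "x \<in> {0..1}" "y \<in> {0..1}"
  shows "f x \<le> f y \<longleftrightarrow> x \<le> y" "f x < f y \<longleftrightarrow> x < y"
  using Homeo_plus_carrierD(4)[OF assms(1)] assms(2,3)
  by (auto simp: strict_mono_on_less_eq strict_mono_on_less)

lemma Homeo_plus_carrier_preimage:
  assumes "f \<in> Homeo_plus_carrier" "y \<in> {0..1}"
  obtains x where "x \<in> {0..1}" "f x = y"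
  using Homeo_plus_carrierD(3)[OF assms(1)] assms(2) unfolding bij_betw_def by (metis imageE)

lemma Homeo_plus_carrier_endpoints:
  assumes f: "f \<in> Homeo_plus_carrier"
  shows "f 0 = 0" "f 1 = 1"
proof -
  obtain x where x: "x \<in> {0..1}" "f x = 0"
    using Homeo_plus_carrier_preimage[OF f, of 0] by auto
  then show "f 0 = 0"
    using Homeo_plus_carrier_mono(1)[OF f, of 0 x] Homeo_plus_carrierD(6)[OF f, of 0] by auto
  obtain x where x: "x \<in> {0..1}" "f x = 1"
    using Homeo_plus_carrier_preimage[OF f, of 1] by auto
  then show "f 1 = 1"
    using Homeo_plus_carrier_mono(1)[OF f, of x 1] Homeo_plus_carrierD(6)[OF f, of 1] by auto
qed

lemma mult_Homeo_plus_apply: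
  assumes "f \<in> Homeo_plus_carrier" "g \<in> Homeo_plus_carrier" "x \<in> {0..1}"
  shows "(f \<otimes>\<^bsub>Homeo_plus\<^esub> g) x = f (g x)"
  using assms by (simp add: mult_Homeo_plus compose_def)

lemma Metric_space_Homeo_plus: "Metric_space Homeo_plus_carrier (mdist Homeo_plus_metric)"
  using Metric_space_mspace_mdist[of Homeo_plus_metric] by (simp add: mspace_Homeo_plus)

lemma Homeo_plus_topology_eq:
  "Homeo_plus_topology = Metric_space.mtopology Homeo_plus_carrier (mdist Homeo_plus_metric)"
  by (simp add: Homeo_plus_topology_def mtopology_of_def mspace_Homeo_plus)

lemma in_closure_of_Homeo_plus_iff:
  assumes "\<Gamma> \<subseteq> Homeo_plus_carrier" "f \<in> Homeo_plus_carrier"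
  shows "f \<in> Homeo_plus_topology closure_of \<Gamma> \<longleftrightarrow>
    (\<forall>e>0. \<exists>g\<in>\<Gamma>. \<forall>x\<in>{0..1}. \<bar>f x - g x\<bar> < e)"
proof -
  interpret M: Metric_space Homeo_plus_carrier "mdist Homeo_plus_metric"
    by (rule Metric_space_Homeo_plus)
  have "g \<in> M.mball f e \<longleftrightarrow> (\<forall>x\<in>{0..1}. \<bar>f x - g x\<bar> < e)" if "g \<in> \<Gamma>" for g e
    using that assms by (auto simp: mdist_Homeo_plus_less_iff)
  then show ?thesis
    using assms(2) unfolding Homeo_plus_topology_eq M.metric_closure_of by auto
qed

section \<open>Generators can be perturbed to share a fixed point\<close>

definition break_map :: "real \<Rightarrow> real \<Rightarrow> real \<Rightarrow> real"
  where "break_map c b =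
    (\<lambda>x\<in>{0..1}. if x \<le> c then x * (b / c) else 1 - (1 - x) * ((1 - b) / (1 - c)))"

text \<open>Exchanging the coordinates of the break point inverts the map.\<close>

lemma break_map_in_Homeo_plus_carrier:
  assumes c: "0 < c" "c < 1" and b: "0 < b" "b < 1"
  shows "break_map c b \<in> Homeo_plus_carrier"
proof (rule strict_mono_Bij_in_Homeo_plus_carrier)
  have left: "0 \<le> x * (b / c) \<and> x * (b / c) \<le> b"
    if "0 \<le> x" "x \<le> c" "0 < c" "0 < b" for x b c :: real
    using that by (simp add: field_simps)
  have right: "b < 1 - (1 - x) * ((1 - b) / (1 - c)) \<and> 1 - (1 - x) * ((1 - b) / (1 - c)) \<le> 1"
    if "c < x" "x \<le> 1" "c < 1" "b < 1" for x b c :: real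
  proof -
    have "(1 - x) * ((1 - b) / (1 - c)) < (1 - c) * ((1 - b) / (1 - c))"
      using that by (intro mult_strict_right_mono) auto
    then show ?thesis
      using that by simp
  qed
  have inverse: "break_map b c (break_map c b x) = x \<and> break_map c b x \<in> {0..1}"
    if "x \<in> {0..1}" "0 < c" "c < 1" "0 < b" "b < 1" for x b c :: real
    using that left[of x c b] right[of c x b] by (auto simp: break_map_def)
  have "bij_betw (break_map c b) {0..1} {0..1}"
    by (rule bij_betw_byWitness[where f' = "break_map b c"]) (use inverse b c in blast)+
  then show "break_map c b \<in> Bij {0..1}"
    by (simp add: Bij_def break_map_def)
  have "break_map c b x < break_map c b y" if "x \<in> {0..1}" "y \<in> {0..1}" "x < y" for x y
  proof -
    consider "y \<le> c" | "x \<le> c" "c < y" | "c < x"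
      using \<open>x < y\<close> by linarith
    then show ?thesis
    proof cases
      case 1
      then have "x * (b / c) < y * (b / c)"
        using that b c by (intro mult_strict_right_mono) auto
      then show ?thesis
        using 1 that by (simp add: break_map_def)
    next
      case 2
      then show ?thesis
        using that left[of x c b] right[of c y b] b c by (auto simp: break_map_def)
    next
      case 3
      then have "(1 - y) * ((1 - b) / (1 - c)) < (1 - x) * ((1 - b) / (1 - c))"
        using that b c by (intro mult_strict_right_mono) auto
      then show ?thesis
        using 3 that by (simp add: break_map_def)
    qed
  qed
  then show "strict_mono_on {0..1} (break_map c b)"
    by (simp add: strict_mono_on_def)
qed

lemma break_map_break: "0 < c \<Longrightarrow> c < 1 \<Longrightarrow> break_map c b c = b"
  by (simp add: break_map_def)

text \<open>A piecewise linear map is furthest from the identity at its break.\<close>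

lemma break_map_close_to_id:
  assumes c: "0 < c" "c < 1" and x: "x \<in> {0..1}"
  shows "\<bar>break_map c b x - x\<bar> \<le> \<bar>b - c\<bar>"
proof (cases "x \<le> c")
  case True
  then have "break_map c b x - x = (x / c) * (b - c)"
    using c x by (simp add: break_map_def field_simps)
  moreover have "\<bar>(x / c) * (b - c)\<bar> \<le> 1 * \<bar>b - c\<bar>"
    unfolding abs_mult by (rule mult_right_mono) (use True c x in simp_all)
  ultimately show ?thesis
    by (simp only: mult_1_left)
next
  case False
  then have "break_map c b x - x = ((1 - x) / (1 - c)) * (b - c)"
    using c x by (simp add: break_map_def field_simps)
  moreover have "\<bar>((1 - x) / (1 - c)) * (b - c)\<bar> \<le> 1 * \<bar>b - c\<bar>"
    unfolding abs_mult by (rule mult_right_mono) (use False c x in simp_all)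
  ultimately show ?thesis
    by (simp only: mult_1_left)
qed

lemma exists_perturbation_fixing_point:
  fixes g :: "nat \<Rightarrow> real \<Rightarrow> real"
  assumes g: "\<And>i. i \<in> A \<Longrightarrow> g i \<in> Homeo_plus_carrier" and A: "finite A" and d: "d > 0"
  shows "\<exists>c u. 0 < c \<and> c < 1 \<and> (\<forall>i\<in>A. u i \<in> Homeo_plus_carrier \<and>
    (\<forall>x\<in>{0..1}. \<bar>u i x - x\<bar> < d) \<and> g i (u i c) = c)"
proof -
  define r where "r = min d (1/2)"
  have r: "0 < r" "r < 1" "r \<le> d"
    using d by (auto simp: r_def)
  have pos: "0 < g i r" if "i \<in> A" for i
    using Homeo_plus_carrier_mono(2)[OF g[OF that], of 0 r] r
      Homeo_plus_carrier_endpoints(1)[OF g[OF that]] by simp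
  \<comment> \<open>Below \<open>g i r\<close> the preimages under \<open>g i\<close> lie below \<open>r\<close>.\<close>
  define m where "m = Min (insert r ((\<lambda>i. g i r) ` A))"
  define c where "c = m / 2"
  have "0 < m"
    using A r pos unfolding m_def by (subst Min_gr_iff) auto
  moreover have "m \<le> r" "\<And>i. i \<in> A \<Longrightarrow> m \<le> g i r"
    using A unfolding m_def by (auto intro!: Min_le)
  ultimately have c: "0 < c" "c < r" and cg: "\<And>i. i \<in> A \<Longrightarrow> c < g i r"
    unfolding c_def by (simp, linarith, fastforce)
  have "\<exists>b. 0 < b \<and> b < r \<and> g i b = c" if i: "i \<in> A" for i
  proof -
    obtain b where b: "b \<in> {0..1}" "g i b = c"
      using Homeo_plus_carrier_preimage[OF g[OF i], of c] c r by auto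
    have "b < r"
      using Homeo_plus_carrier_mono(2)[OF g[OF i], of b r] b cg[OF i] r by simp
    moreover have "b \<noteq> 0"
      using Homeo_plus_carrier_endpoints(1)[OF g[OF i]] b c by auto
    ultimately show ?thesis
      using b by (intro exI[of _ b]) auto
  qed
  then obtain b where b: "\<And>i. i \<in> A \<Longrightarrow> 0 < b i \<and> b i < r \<and> g i (b i) = c"
    by metis
  have "break_map c (b i) \<in> Homeo_plus_carrier \<and>
    (\<forall>x\<in>{0..1}. \<bar>break_map c (b i) x - x\<bar> < d) \<and> g i (break_map c (b i) c) = c"
    if i: "i \<in> A" for i
  proof (intro conjI ballI)
    show "break_map c (b i) \<in> Homeo_plus_carrier"
      using b[OF i] c r by (intro break_map_in_Homeo_plus_carrier) auto
    show "g i (break_map c (b i) c) = c"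
      using b[OF i] c r by (simp add: break_map_break)
    fix x :: real assume "x \<in> {0..1}"
    then have "\<bar>break_map c (b i) x - x\<bar> \<le> \<bar>b i - c\<bar>"
      using c r by (intro break_map_close_to_id) auto
    then show "\<bar>break_map c (b i) x - x\<bar> < d"
      using b[OF i] c r by linarith
  qed
  then show ?thesis
    using c r by (intro exI[of _ c] exI[of _ "\<lambda>i. break_map c (b i)"]) auto
qed

lemma generate_fixes_point:
  assumes B: "B \<subseteq> Homeo_plus_carrier" and c: "c \<in> {0..1}"
    and fixes_c: "\<And>h. h \<in> B \<Longrightarrow> h c = c" and k: "k \<in> generate Homeo_plus B"
  shows "k c = c"
proof -
  have sub: "generate Homeo_plus B \<subseteq> Homeo_plus_carrier"
    using group.generate_incl[OF group_Homeo_plus] B by (simp add: carrier_Homeo_plus)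
  show ?thesis
    using k
  proof (induction k rule: generate.induct)
    case one
    then show ?case
      using c by (simp add: one_Homeo_plus)
  next
    case (incl h)
    then show ?case
      by (rule fixes_c)
  next
    case (inv h)
    then have h: "h \<in> Homeo_plus_carrier"
      using B by blast
    then have "inv_into {0..1} h (h c) = c"
      using Homeo_plus_carrierD(3)[OF h] c by (auto simp: bij_betw_def)
    then show ?case
      using c by (simp add: inv_Homeo_plus[OF h] fixes_c[OF inv])
  next
    case (eng h1 h2)
    then have "h1 \<in> Homeo_plus_carrier" "h2 \<in> Homeo_plus_carrier"
      using sub by auto
    then show ?case
      using eng c by (simp add: mult_Homeo_plus_apply)
  qed
qed

lemma not_dense_if_common_fixed_point:
  assumes B: "B \<subseteq> Homeo_plus_carrier" and c: "0 < c" "c < 1"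
    and fixes_c: "\<And>h. h \<in> B \<Longrightarrow> h c = c"
  shows "Homeo_plus_topology closure_of generate Homeo_plus B \<noteq> topspace Homeo_plus_topology"
proof
  assume "Homeo_plus_topology closure_of generate Homeo_plus B = topspace Homeo_plus_topology"
  moreover define f where "f = break_map c (c / 2)"
  moreover have f: "f \<in> Homeo_plus_carrier"
    using c unfolding f_def by (intro break_map_in_Homeo_plus_carrier) auto
  moreover have "generate Homeo_plus B \<subseteq> Homeo_plus_carrier"
    using group.generate_incl[OF group_Homeo_plus] B by (simp add: carrier_Homeo_plus)
  ultimately have "\<forall>e>0. \<exists>k\<in>generate Homeo_plus B. \<forall>x\<in>{0..1}. \<bar>f x - k x\<bar> < e"
    using in_closure_of_Homeo_plus_iff by (metis topspace_Homeo_plus)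
  then obtain k where k: "k \<in> generate Homeo_plus B" "\<forall>x\<in>{0..1}. \<bar>f x - k x\<bar> < c / 2"
    using c by (metis half_gt_zero)
  have "k c = c"
    using c by (intro generate_fixes_point[OF B _ _ k(1)] fixes_c) auto
  moreover have "f c = c / 2"
    using c by (simp add: f_def break_map_break)
  ultimately show False
    using k(2)[rule_format, of c] c by (simp add: abs_if split: if_splits)
qed

section \<open>A density criterion\<close>

text \<open>Let \<open>y\<^sub>j = j / N\<close> and let \<open>x\<^sub>j\<close> be its preimage under the homeomorphism \<open>f\<close> to be
  approximated. It suffices to find \<open>\<gamma> \<in> \<Gamma>\<close> with \<open>y\<^sub>j < \<gamma> x\<^sub>j < y\<^sub>j\<^sub>+\<^sub>1\<close> for \<open>0 < j < N\<close>, because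
  monotonicity controls \<open>\<gamma>\<close> between grid points. The points are placed from left to right; the
  hypothesis supplies an element that places the next point and leaves the earlier ones alone.\<close>

lemma dense_if_pushes_points:
  assumes \<Gamma>: "subgroup \<Gamma> Homeo_plus"
    and push: "\<And>p x u v :: real. \<lbrakk>0 \<le> p; p < x; x < 1; p < v; u < v; v \<le> 1\<rbrakk> \<Longrightarrow>
      \<exists>k\<in>\<Gamma>. (\<forall>t\<in>{0..p}. k t = t) \<and> u < k x \<and> k x < v"
  shows "Homeo_plus_topology closure_of \<Gamma> = topspace Homeo_plus_topology"
proof -
  have sub: "\<Gamma> \<subseteq> Homeo_plus_carrier"
    using subgroup.subset[OF \<Gamma>] by (simp add: carrier_Homeo_plus)
  have "f \<in> Homeo_plus_topology closure_of \<Gamma>" if f: "f \<in> Homeo_plus_carrier" for f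
    unfolding in_closure_of_Homeo_plus_iff[OF sub f]
  proof (intro allI impI)
    fix e :: real assume e: "e > 0"
    \<comment> \<open>Between two grid points, \<open>f\<close> and the approximation can differ by two grid steps.\<close>
    define N :: nat where "N = nat \<lceil>2 / e\<rceil> + 1"
    have N: "real N > 2 / e" "N > 0"
      unfolding N_def by linarith+
    define y where "y j = real j / real N" for j
    have y_mono: "y i < y j" if "i < j" for i j
      using that N by (simp add: y_def divide_strict_right_mono)
    have yI: "y j \<in> {0..1}" if "j \<le> N" for j
      using that N by (simp add: y_def)
    have "\<exists>a. a \<in> {0..1} \<and> f a = y j" if "j \<le> N" for j
      using Homeo_plus_carrier_preimage[OF f yI[OF that]] by metis
    then obtain x where x: "\<And>j. j \<le> N \<Longrightarrow> x j \<in> {0..1} \<and> f (x j) = y j"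
      by metis
    have x_mono: "x i < x j" if "i < j" "j \<le> N" for i j
      using Homeo_plus_carrier_mono(2)[OF f, of "x i" "x j"] x[of i] x[of j] y_mono[of i j] that
      by auto
    have x0: "x 0 = 0"
      using Homeo_plus_carrier_mono(1)[OF f, of "x 0" 0] x[of 0]
        Homeo_plus_carrier_endpoints(1)[OF f] by (auto simp: y_def)
    have x1: "x N = 1"
      using Homeo_plus_carrier_mono(1)[OF f, of 1 "x N"] x[of N] N
        Homeo_plus_carrier_endpoints(2)[OF f] by (auto simp: y_def)
    have "\<exists>k\<in>\<Gamma>. \<forall>j\<in>{1..n}. y j < k (x j) \<and> k (x j) < y (j + 1)" if "n < N" for n
      using that
    proof (induction n)
      case 0
      then show ?case
        using subgroup.one_closed[OF \<Gamma>] by auto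
    next
      case (Suc n)
      then obtain k where k: "k \<in> \<Gamma>" "\<forall>j\<in>{1..n}. y j < k (x j) \<and> k (x j) < y (j + 1)"
        by auto
      have kH: "k \<in> Homeo_plus_carrier"
        using k sub by blast
      have xI: "x j \<in> {0..1}" if "j \<le> Suc n" for j
        using x[of j] that Suc.prems by simp
      have kI: "k (x j) \<in> {0..1}" if "j \<le> Suc n" for j
        using Homeo_plus_carrierD(6)[OF kH] xI that by blast
      have k_lt: "k (x n) < k (x (Suc n))"
        using Homeo_plus_carrier_mono(2)[OF kH] x_mono[of n "Suc n"] xI Suc.prems by auto
      have k_lt_1: "k (x (Suc n)) < 1"
        using Homeo_plus_carrier_mono(2)[OF kH, of "x (Suc n)" 1] x_mono[of "Suc n" N] x1
          xI[of "Suc n"] Homeo_plus_carrier_endpoints(2)[OF kH] Suc.prems by auto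
      have "k (x n) \<le> y (n + 1)"
      proof (cases "n = 0")
        case True
        then show ?thesis
          using x0 Homeo_plus_carrier_endpoints(1)[OF kH] by (simp add: y_def)
      next
        case False
        then show ?thesis
          using bspec[OF k(2), of n] by simp
      qed
      then have "k (x n) < y (n + 2)"
        using y_mono[of "n + 1" "n + 2"] by simp
      then obtain l where l: "l \<in> \<Gamma>" "\<forall>t\<in>{0..k (x n)}. l t = t"
          "y (n + 1) < l (k (x (Suc n)))" "l (k (x (Suc n))) < y (n + 2)"
        using push[of "k (x n)" "k (x (Suc n))" "y (n + 2)" "y (n + 1)"] kI[of n] k_lt k_lt_1
          y_mono[of "n + 1" "n + 2"] yI[of "n + 2"] Suc.prems by auto
      have lH: "l \<in> Homeo_plus_carrier"
        using l sub by blast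
      have lk: "(l \<otimes>\<^bsub>Homeo_plus\<^esub> k) (x j) = l (k (x j))" if "j \<le> Suc n" for j
        using mult_Homeo_plus_apply[OF lH kH xI[OF that]] .
      have "y j < (l \<otimes>\<^bsub>Homeo_plus\<^esub> k) (x j) \<and> (l \<otimes>\<^bsub>Homeo_plus\<^esub> k) (x j) < y (j + 1)"
        if j: "j \<in> {1..Suc n}" for j
      proof (cases "j = Suc n")
        case True
        then show ?thesis
          using lk l(3,4) by simp
      next
        case False
        then have "x j \<le> x n"
          using x_mono[of j n] j Suc.prems by (cases "j = n") auto
        then have "k (x j) \<in> {0..k (x n)}"
          using Homeo_plus_carrier_mono(1)[OF kH] xI[of j] xI[of n] kI[of j] j by auto
        then have "l (k (x j)) = k (x j)"
          using l(2) by blast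
        then show ?thesis
          using k(2) lk[of j] False j by auto
      qed
      then show ?case
        using subgroup.m_closed[OF \<Gamma> l(1) k(1)] by blast
    qed
    then obtain k where k: "k \<in> \<Gamma>" "\<forall>j\<in>{1..N - 1}. y j < k (x j) \<and> k (x j) < y (j + 1)"
      using N by (metis diff_less zero_less_one)
    have kH: "k \<in> Homeo_plus_carrier"
      using k sub by blast
    have k_lower: "y j \<le> k (x j)" if "j < N" for j
    proof (cases "j = 0")
      case True
      then show ?thesis
        using x0 Homeo_plus_carrier_endpoints(1)[OF kH] by (simp add: y_def)
    next
      case False
      then show ?thesis
        using k(2) that by (simp add: less_imp_le)
    qed
    have k_upper: "k (x j) \<le> y (j + 1)" if "0 < j" "j \<le> N" for j
    proof (cases "j = N")
      case True
      then show ?thesis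
        using x1 Homeo_plus_carrier_endpoints(2)[OF kH] N by (simp add: y_def field_simps)
    next
      case False
      then show ?thesis
        using k(2) that by (simp add: less_imp_le)
    qed
    have "\<bar>f t - k t\<bar> < e" if t: "t \<in> {0..1}" for t
    proof (cases "t = 1")
      case True
      then show ?thesis
        using e Homeo_plus_carrier_endpoints(2)[OF f] Homeo_plus_carrier_endpoints(2)[OF kH]
        by simp
    next
      case False
      have ft: "0 \<le> f t" "f t < 1"
        using Homeo_plus_carrierD(6)[OF f t] Homeo_plus_carrier_mono(2)[OF f t, of 1] False t
          Homeo_plus_carrier_endpoints(2)[OF f] by auto
      define j where "j = nat \<lfloor>f t * real N\<rfloor>"
      have jle: "real j \<le> f t * real N" "f t * real N < real j + 1"
        using ft N unfolding j_def by (auto simp: of_nat_nat floor_le_iff)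
      then have yj: "y j \<le> f t" "f t < y (j + 1)"
        using N by (auto simp: y_def field_simps)
      have "f t * real N < real N"
        using ft N by simp
      then have jN: "j < N"
        using jle by linarith
      have "x j \<le> t" "t < x (j + 1)"
        using Homeo_plus_carrier_mono(1)[OF f, of "x j" t] x[of j] yj t jN
          Homeo_plus_carrier_mono(2)[OF f, of t "x (j + 1)"] x[of "j + 1"] by auto
      then have "k (x j) \<le> k t" "k t < k (x (j + 1))"
        using Homeo_plus_carrier_mono(1)[OF kH, of "x j" t] x[of j] t jN
          Homeo_plus_carrier_mono(2)[OF kH, of t "x (j + 1)"] x[of "j + 1"] by auto
      then have "y j \<le> k t" "k t < y (j + 2)"
        using k_lower[OF jN] k_upper[of "j + 1"] jN by (auto simp: add.assoc)
      moreover have "y (j + 2) - y j < e"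
        using N e by (simp add: y_def field_simps)
      ultimately show ?thesis
        using yj y_mono[of "j + 1" "j + 2"] by auto
    qed
    then show "\<exists>k\<in>\<Gamma>. \<forall>x\<in>{0..1}. \<bar>f x - k x\<bar> < e"
      using k(1) by blast
  qed
  then show ?thesis
    using closure_of_subset_topspace[of Homeo_plus_topology \<Gamma>] by (auto simp: topspace_Homeo_plus)
qed

section \<open>From the real line to the unit interval\<close>

definition line_to_interval :: "real \<Rightarrow> real"
  where "line_to_interval t = arctan t / pi + 1 / 2"

definition interval_to_line :: "real \<Rightarrow> real"
  where "interval_to_line x = tan (pi * (x - 1 / 2))"

definition interval_map :: "(real \<Rightarrow> real) \<Rightarrow> real \<Rightarrow> real"
  where "interval_map f = (\<lambda>x\<in>{0..1}. if x \<in> {0<..<1}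
    then line_to_interval (f (interval_to_line x)) else x)"

lemma line_to_interval_bounds: "0 < line_to_interval t" "line_to_interval t < 1"
proof -
  have "- 1 / 2 < arctan t / pi" "arctan t / pi < 1 / 2"
    using arctan_lbound[of t] arctan_ubound[of t] pi_gt_zero by (simp_all add: divide_simps)
  then show "0 < line_to_interval t" "line_to_interval t < 1"
    unfolding line_to_interval_def by linarith+
qed

lemma interval_to_line_inverse: "interval_to_line (line_to_interval t) = t"
  by (simp add: interval_to_line_def line_to_interval_def tan_arctan)

lemma line_to_interval_inverse:
  assumes "x \<in> {0<..<1}"
  shows "line_to_interval (interval_to_line x) = x"
proof -
  have "pi * x < pi * 1" "0 < pi * x"
    using assms by simp_all
  then have "- (pi / 2) < pi * (x - 1 / 2)" "pi * (x - 1 / 2) < pi / 2"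
    by (simp_all add: algebra_simps)
  then have "arctan (interval_to_line x) = pi * (x - 1 / 2)"
    unfolding interval_to_line_def by (rule arctan_tan)
  then show ?thesis
    by (simp add: line_to_interval_def)
qed

lemma line_to_interval_less_iff: "line_to_interval s < line_to_interval t \<longleftrightarrow> s < t"
  by (simp add: line_to_interval_def divide_less_cancel arctan_less_iff)

lemma line_to_interval_surj:
  assumes "x \<in> {0<..<1}"
  obtains t where "x = line_to_interval t"
  using line_to_interval_inverse[OF assms] by metis

lemma interval_map_line_to_interval:
  "interval_map f (line_to_interval t) = line_to_interval (f t)"
  using line_to_interval_bounds[of t]
  by (simp add: interval_map_def interval_to_line_inverse less_imp_le)

lemma interval_map_id: "interval_map (\<lambda>x. x) = (\<lambda>x\<in>{0..1}. x)"
  by (auto simp: interval_map_def line_to_interval_inverse)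

lemma interval_map_endpoints: "interval_map f 0 = 0" "interval_map f 1 = 1"
  by (simp_all add: interval_map_def)

lemma compose_interval_map:
  "compose {0..1} (interval_map f) (interval_map g) = interval_map (\<lambda>x. f (g x))"
proof
  fix x :: real
  consider "x = 0" | "x = 1" | "x \<in> {0<..<1}" | "x \<notin> {0..1}"
    by fastforce
  then show "compose {0..1} (interval_map f) (interval_map g) x = interval_map (\<lambda>x. f (g x)) x"
  proof cases
    case 3
    then obtain t where "x = line_to_interval t"
      by (rule line_to_interval_surj)
    then show ?thesis
      using 3 by (simp add: compose_def interval_map_line_to_interval)
  qed (auto simp: compose_def interval_map_endpoints interval_map_def)
qed

definition line_homeo :: "(real \<Rightarrow> real) \<Rightarrow> bool"
  where "line_homeo f \<longleftrightarrow> strict_mono f \<and> surj f"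

lemma line_homeoI:
  assumes "strict_mono f" "\<And>x. f (g x) = x"
  shows "line_homeo f"
  using assms unfolding line_homeo_def by (metis surjI)

lemma interval_map_in_Homeo_plus_carrier:
  assumes f: "line_homeo f"
  shows "interval_map f \<in> Homeo_plus_carrier"
proof (rule strict_mono_Bij_in_Homeo_plus_carrier)
  have mono: "strict_mono f" and "surj f"
    using f by (auto simp: line_homeo_def)
  then obtain f' where f': "\<And>x. f (f' x) = x"
    by (metis surjD)
  then have inverse: "f' (f x) = x" for x
    using mono by (metis strict_mono_eq)
  have comp: "interval_map g (interval_map h x) = x"
    if "\<And>x. g (h x) = x" "x \<in> {0..1}" for g h x
    using fun_cong[OF compose_interval_map, of g h x] that
    by (simp add: compose_def interval_map_id)
  have I: "interval_map h x \<in> {0..1}" if "x \<in> {0..1}" for h x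
    using that line_to_interval_bounds by (simp add: interval_map_def less_imp_le)
  have "bij_betw (interval_map f) {0..1} {0..1}"
    by (rule bij_betw_byWitness[where f' = "interval_map f'"])
       (use comp[of f f'] comp[of f' f] f' inverse I in auto)
  then show "interval_map f \<in> Bij {0..1}"
    by (simp add: Bij_def interval_map_def)
  show "strict_mono_on {0..1} (interval_map f)"
  proof (rule strict_mono_onI)
    fix x y :: real assume xy: "x \<in> {0..1}" "y \<in> {0..1}" "x < y"
    consider "x = 0" "y = 1" | "x = 0" "y \<in> {0<..<1}" | "x \<in> {0<..<1}" "y = 1"
      | "x \<in> {0<..<1}" "y \<in> {0<..<1}"
      using xy by fastforce
    then show "interval_map f x < interval_map f y"
    proof cases
      case 4
      then obtain s t where "x = line_to_interval s" "y = line_to_interval t"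
        by (metis line_to_interval_surj)
      then show ?thesis
        using xy mono
        by (simp add: interval_map_line_to_interval line_to_interval_less_iff strict_monoD)
    next
      case 2
      then obtain t where "y = line_to_interval t"
        by (metis line_to_interval_surj)
      then show ?thesis
        using 2
        by (simp add: interval_map_endpoints interval_map_line_to_interval line_to_interval_bounds)
    next
      case 3
      then obtain t where "x = line_to_interval t"
        by (metis line_to_interval_surj)
      then show ?thesis
        using 3
        by (simp add: interval_map_endpoints interval_map_line_to_interval line_to_interval_bounds)
    qed (simp add: interval_map_endpoints)
  qed
qed

section \<open>A finitely generated dense subgroup\<close>

definition dense_group :: "(real \<Rightarrow> real) set"
  where "dense_group = generate Homeo_plus
    {interval_map (\<lambda>x. x + 1), interval_map (\<lambda>x. 2 * x), interval_map (\<lambda>x. max x (2 * x))}"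

definition line_group :: "(real \<Rightarrow> real) set"
  where "line_group = {f. line_homeo f \<and> interval_map f \<in> dense_group}"

lemma line_homeo_generators:
  "line_homeo (\<lambda>x. x + 1)" "line_homeo (\<lambda>x. 2 * x)" "line_homeo (\<lambda>x. max x (2 * x))"
  by (rule line_homeoI[where g = "\<lambda>x. x - 1"] line_homeoI[where g = "\<lambda>x. x / 2"]
      line_homeoI[where g = "\<lambda>x. min x (x / 2)"]; auto simp: strict_mono_def max_def min_def)+

lemma subgroup_dense_group: "subgroup dense_group Homeo_plus"
  unfolding dense_group_def
  by (rule group.generate_is_subgroup[OF group_Homeo_plus])
     (simp add: carrier_Homeo_plus interval_map_in_Homeo_plus_carrier line_homeo_generators)

lemma line_group_generators:
  "(\<lambda>x. x + 1) \<in> line_group" "(\<lambda>x. 2 * x) \<in> line_group" "(\<lambda>x. max x (2 * x)) \<in> line_group"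
  by (simp_all add: line_group_def line_homeo_generators dense_group_def generate.incl)

lemma line_group_id: "(\<lambda>x. x) \<in> line_group"
  using subgroup.one_closed[OF subgroup_dense_group]
  by (simp add: line_group_def line_homeo_def strict_mono_def interval_map_id one_Homeo_plus)

lemma line_group_comp:
  assumes "f \<in> line_group" "g \<in> line_group"
  shows "(\<lambda>x. f (g x)) \<in> line_group"
proof -
  have fg: "line_homeo f" "line_homeo g" "interval_map f \<in> dense_group" "interval_map g \<in> dense_group"
    using assms by (auto simp: line_group_def)
  have "surj (f \<circ> g)"
    using fg(1,2) by (intro comp_surj) (auto simp: line_homeo_def)
  then have "line_homeo (\<lambda>x. f (g x))"
    using fg(1,2) by (simp add: line_homeo_def strict_mono_def comp_def)
  moreover have "interval_map (\<lambda>x. f (g x)) \<in> dense_group"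
    using subgroup.m_closed[OF subgroup_dense_group fg(3,4)] fg(1,2)
    by (simp add: mult_Homeo_plus interval_map_in_Homeo_plus_carrier compose_interval_map)
  ultimately show ?thesis
    by (simp add: line_group_def)
qed

lemma line_group_inverse:
  assumes f: "f \<in> line_group" and inv: "\<And>x. f (g x) = x"
  shows "g \<in> line_group"
proof -
  interpret group Homeo_plus by (rule group_Homeo_plus)
  have F: "line_homeo f" "interval_map f \<in> dense_group"
    using f by (auto simp: line_group_def)
  have less: "f x < f y \<longleftrightarrow> x < y" for x y
    using F(1) by (simp add: line_homeo_def strict_mono_less)
  then have inv': "g (f x) = x" for x
    using inv by (metis linorder_neqE_linordered_idom less_irrefl)
  have "strict_mono g"
    using less inv by (metis strict_monoI)
  then have g: "line_homeo g"
    by (rule line_homeoI) (rule inv')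
  have "interval_map g \<otimes>\<^bsub>Homeo_plus\<^esub> interval_map f = \<one>\<^bsub>Homeo_plus\<^esub>"
    using F(1) g
    by (simp add: mult_Homeo_plus interval_map_in_Homeo_plus_carrier compose_interval_map inv'
        interval_map_id one_Homeo_plus)
  then have "interval_map g = inv\<^bsub>Homeo_plus\<^esub> interval_map f"
    using F(1) g interval_map_in_Homeo_plus_carrier
    by (intro inv_equality[symmetric]) (auto simp: carrier_Homeo_plus)
  then show ?thesis
    using g subgroup.m_inv_closed[OF subgroup_dense_group F(2)] by (simp add: line_group_def)
qed

text \<open>Conjugating by \<open>2 * x\<close> halves a translation.\<close>

lemma dyadic_translation_in_line_group: "(\<lambda>x. x + of_int k / 2 ^ n) \<in> line_group"
proof -
  have unit: "(\<lambda>x. x + 1 / 2 ^ n) \<in> line_group"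
  proof (induction n)
    case 0
    then show ?case
      using line_group_generators(1) by simp
  next
    case (Suc n)
    have "(\<lambda>x. x / 2) \<in> line_group"
      by (rule line_group_inverse[OF line_group_generators(2)]) simp
    from line_group_comp[OF this line_group_comp[OF Suc line_group_generators(2)]]
    show ?case
      by (simp add: add_divide_distrib mult.commute)
  qed
  have nat: "(\<lambda>x. x + real m / 2 ^ n) \<in> line_group" for m
  proof (induction m)
    case 0
    then show ?case
      using line_group_id by simp
  next
    case (Suc m)
    from line_group_comp[OF this unit] show ?case
      by (simp add: add_divide_distrib algebra_simps)
  qed
  show ?thesis
  proof (cases "0 \<le> k")
    case True
    then show ?thesis
      using nat[of "nat k"] by (simp add: of_nat_nat)
  next
    case False
    then show ?thesis
      using line_group_inverse[OF nat[of "nat (- k)"], of "\<lambda>x. x + of_int k / 2 ^ n"]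
      by (simp add: of_nat_nat)
  qed
qed

lemma translations_dense:
  assumes "p < (q :: real)"
  obtains s where "p < s" "s < q" "(\<lambda>x. x + s) \<in> line_group"
proof -
  obtain n where n: "(1 / 2) ^ n < q - p"
    using real_arch_pow_inv[of "q - p" "1 / 2"] assms by auto
  define k where "k = \<lfloor>p * 2 ^ n\<rfloor> + 1"
  have k: "p * 2 ^ n < of_int k" "of_int k \<le> p * 2 ^ n + 1"
    unfolding k_def by linarith+
  have "p < of_int k / 2 ^ n"
    using k(1) by (simp add: field_simps)
  moreover have "of_int k / 2 ^ n \<le> p + (1 / 2) ^ n"
    using k(2) by (simp add: field_simps power_divide)
  ultimately show thesis
    using n that[of "of_int k / 2 ^ n"] dyadic_translation_in_line_group by simp
qed

text \<open>This is \<open>max x (2 * x)\<close> conjugated by a translation: the identity up to \<open>s\<close>, and expansion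
  by \<open>2\<close> around \<open>s\<close> beyond.\<close>

lemma half_line_doubling_in_line_group:
  assumes s: "(\<lambda>x. x + s) \<in> line_group"
  shows "(\<lambda>x. max x (2 * x - s)) \<in> line_group"
proof -
  have "(\<lambda>x. x - s) \<in> line_group"
    by (rule line_group_inverse[OF s]) simp
  from line_group_comp[OF s line_group_comp[OF line_group_generators(3) this]]
  have "(\<lambda>x. max (x - s) (2 * (x - s)) + s) \<in> line_group" .
  moreover have "max (x - s) (2 * (x - s)) + s = max x (2 * x - s)" for x
    by (simp add: max_def)
  ultimately show ?thesis
    by simp
qed

lemma doubling_hits_interval:
  fixes a b :: real
  assumes P: "P a" and double: "\<And>z. P z \<Longrightarrow> P (2 * z)" and half: "\<And>z. P z \<Longrightarrow> P (z / 2)"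
    and pos: "0 < a" "0 < b"
  shows "\<exists>z. P z \<and> z < b \<and> b \<le> 2 * z"
proof -
  obtain m where m: "(1 / 2) ^ m < b / a"
    using real_arch_pow_inv[of "b / a" "1 / 2"] pos by auto
  define c where "c = a * (1 / 2) ^ m"
  have "P (a * (1 / 2) ^ m)" for m
  proof (induction m)
    case (Suc m)
    then show ?case
      using half[of "a * (1 / 2) ^ m"] by simp
  qed (simp add: P)
  then have c: "P c" "0 < c" "c < b"
    using m pos by (auto simp: c_def field_simps)
  have Pc: "P (2 ^ k * c)" for k
  proof (induction k)
    case (Suc k)
    then show ?case
      using double[of "2 ^ k * c"] by (simp add: mult.assoc)
  qed (simp add: c)
  obtain k0 where "b / c < 2 ^ k0"
    using real_arch_pow[of 2 "b / c"] by auto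
  then have "b \<le> 2 ^ k0 * c"
    using c by (simp add: field_simps)
  moreover have "\<not> b \<le> 2 ^ 0 * c"
    using c by simp
  ultimately obtain k where "\<not> b \<le> 2 ^ k * c" "b \<le> 2 ^ Suc k * c"
    using ex_least_nat_less[of "\<lambda>k. b \<le> 2 ^ k * c" k0] by auto
  then show ?thesis
    using Pc[of k] by (intro exI[of _ "2 ^ k * c"]) auto
qed

text \<open>Doublings and halvings around a fixed \<open>s\<close> bring \<open>x\<close> to a point \<open>w\<close> with
  \<open>w < v \<le> 2 * w - s\<close>. One more doubling, around a different point \<open>r\<close>, moves \<open>w\<close> to
  \<open>2 * w - r\<close>. As \<open>r\<close> ranges over a dense subset of \<open>(s, w)\<close>, these values range over a dense
  subset of \<open>(w, 2 * w - s)\<close>, an interval that meets \<open>(u, v)\<close> just below \<open>v\<close>.\<close>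

lemma push_point_into_interval:
  fixes p x u v :: real
  assumes "p < x" "p < v" "u < v"
  shows "\<exists>f\<in>line_group. (\<forall>t\<le>p. f t = t) \<and> u < f x \<and> f x < v"
proof -
  obtain s where s: "p < s" "s < min x v" "(\<lambda>x. x + s) \<in> line_group"
    using translations_dense[of p "min x v"] assms by auto
  define reach where "reach z \<longleftrightarrow> (\<exists>f\<in>line_group. (\<forall>t\<le>p. f t = t) \<and> f x = s + z)" for z
  \<comment> \<open>A reachable point above \<open>s\<close> may be doubled or halved around \<open>s\<close>; the positivity of \<open>z\<close> is
    part of the invariant because below \<open>s\<close> these maps are the identity.\<close>
  have "\<exists>z. (0 < z \<and> reach z) \<and> z < v - s \<and> v - s \<le> 2 * z"
  proof (rule doubling_hits_interval[where a = "x - s"])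
    show "0 < x - s \<and> reach (x - s)"
      using s line_group_id unfolding reach_def by (auto intro!: bexI[of _ "\<lambda>x. x"])
    note d = half_line_doubling_in_line_group[OF s(3)]
    have h: "(\<lambda>x. min x ((x + s) / 2)) \<in> line_group"
      by (rule line_group_inverse[OF d]) (auto simp: max_def min_def field_simps)
    fix z assume z: "0 < z \<and> reach z"
    then obtain f where f: "f \<in> line_group" "\<forall>t\<le>p. f t = t" "f x = s + z"
      by (auto simp: reach_def)
    show "0 < 2 * z \<and> reach (2 * z)"
      unfolding reach_def
    proof (intro conjI bexI[of _ "\<lambda>x. max (f x) (2 * f x - s)"] allI impI)
      show "(\<lambda>x. max (f x) (2 * f x - s)) \<in> line_group"
        using line_group_comp[OF d f(1)] .
    qed (use z f s(1) in auto)
    show "0 < z / 2 \<and> reach (z / 2)"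
      unfolding reach_def
    proof (intro conjI bexI[of _ "\<lambda>x. min (f x) ((f x + s) / 2)"] allI impI)
      show "(\<lambda>x. min (f x) ((f x + s) / 2)) \<in> line_group"
        using line_group_comp[OF h f(1)] .
    qed (use z f s(1) in \<open>auto simp: min_def\<close>)
  qed (use s in auto)
  then obtain z f where z: "0 < z" "z < v - s" "v - s \<le> 2 * z"
    and f: "f \<in> line_group" "\<forall>t\<le>p. f t = t" "f x = s + z"
    by (auto simp: reach_def)
  define w where "w = s + z"
  have "max (2 * w - v) s < min (2 * w - u) w"
    using z assms by (auto simp: w_def)
  then obtain r where r: "max (2 * w - v) s < r" "r < min (2 * w - u) w" "(\<lambda>x. x + r) \<in> line_group"
    using translations_dense by blast
  show ?thesis
  proof (intro bexI[of _ "\<lambda>x. max (f x) (2 * f x - r)"] conjI allI impI)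
    show "(\<lambda>x. max (f x) (2 * f x - r)) \<in> line_group"
      using line_group_comp[OF half_line_doubling_in_line_group[OF r(3)] f(1)] .
  next
    fix t assume "t \<le> p"
    then show "max (f t) (2 * f t - r) = t"
      using f(2) r(1) s(1) by auto
  next
    show "u < max (f x) (2 * f x - r)" "max (f x) (2 * f x - r) < v"
      using f(3) r(1,2) z by (auto simp: w_def)
  qed
qed

lemma dense_group_dense: "Homeo_plus_topology closure_of dense_group = topspace Homeo_plus_topology"
proof (rule dense_if_pushes_points[OF subgroup_dense_group])
  fix p x u v :: real
  assume A: "0 \<le> p" "p < x" "x < 1" "p < v" "u < v" "v \<le> 1"
  \<comment> \<open>Move \<open>p\<close>, \<open>u\<close> and \<open>v\<close> inwards, since the line only sees interior points.\<close>
  obtain p' where p': "p < p'" "p' < x" "p' < v"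
    using dense[of p "min x v"] A by auto
  obtain v' where v': "max u p' < v'" "v' < v"
    using dense[of "max u p'" v] A p' by auto
  obtain u' where u': "max u p' < u'" "u' < v'"
    using dense[of "max u p'" v'] v' by auto
  have in01: "p' \<in> {0<..<1}" "x \<in> {0<..<1}" "u' \<in> {0<..<1}" "v' \<in> {0<..<1}"
    using A p' u' v' by auto
  obtain a b c d where L: "p' = line_to_interval a" "x = line_to_interval b"
      "u' = line_to_interval c" "v' = line_to_interval d"
    using in01 by (metis line_to_interval_surj)
  have "a < b" "a < d" "c < d"
    using p' u' v' unfolding L by (auto simp: line_to_interval_less_iff)
  then obtain f where f: "f \<in> line_group" "\<forall>t\<le>a. f t = t" "c < f b" "f b < d"
    using push_point_into_interval by blast
  have "interval_map f t = t" if t: "t \<in> {0..p}" for t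
  proof (cases "t = 0")
    case False
    then have "t \<in> {0<..<1}"
      using t A by auto
    then obtain e where e: "t = line_to_interval e"
      by (rule line_to_interval_surj)
    have "e < a"
      using t p' L(1) e line_to_interval_less_iff[of e a] by auto
    then show ?thesis
      using f(2) by (simp add: e interval_map_line_to_interval)
  qed (simp add: interval_map_endpoints)
  moreover have "u' < interval_map f x" "interval_map f x < v'"
    using f(3,4) by (simp_all add: L interval_map_line_to_interval line_to_interval_less_iff)
  then have "u < interval_map f x" "interval_map f x < v"
    using u' v' by auto
  moreover have "interval_map f \<in> dense_group"
    using f(1) by (simp add: line_group_def)
  ultimately show "\<exists>k\<in>dense_group. (\<forall>t\<in>{0..p}. k t = t) \<and> u < k x \<and> k x < v"
    by blast
qed

section \<open>Failure of stability\<close>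

lemma no_stable_generators:
  fixes g :: "nat \<Rightarrow> real \<Rightarrow> real"
  assumes g: "\<And>i. i \<in> A \<Longrightarrow> g i \<in> Homeo_plus_carrier" and A: "finite A"
    and U: "openin Homeo_plus_topology U" "\<one>\<^bsub>Homeo_plus\<^esub> \<in> U"
  shows "\<exists>h. (\<forall>i\<in>A. h i \<in> g i <#\<^bsub>Homeo_plus\<^esub> U) \<and>
    Homeo_plus_topology closure_of generate Homeo_plus (h ` A) \<noteq> topspace Homeo_plus_topology"
proof -
  interpret group Homeo_plus by (rule group_Homeo_plus)
  interpret M: Metric_space Homeo_plus_carrier "mdist Homeo_plus_metric"
    by (rule Metric_space_Homeo_plus)
  have oneH: "\<one>\<^bsub>Homeo_plus\<^esub> \<in> Homeo_plus_carrier"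
    using one_closed by (simp add: carrier_Homeo_plus)
  obtain d where d: "d > 0" "M.mball \<one>\<^bsub>Homeo_plus\<^esub> d \<subseteq> U"
    using U unfolding Homeo_plus_topology_eq M.openin_mtopology by blast
  obtain c u where c: "0 < c" "c < 1" and "\<forall>i\<in>A. u i \<in> Homeo_plus_carrier \<and>
      (\<forall>x\<in>{0..1}. \<bar>u i x - x\<bar> < d) \<and> g i (u i c) = c"
    using exists_perturbation_fixing_point[of A g d] g A d(1) by blast
  then have u: "u i \<in> Homeo_plus_carrier" "\<forall>x\<in>{0..1}. \<bar>u i x - x\<bar> < d" "g i (u i c) = c"
    if "i \<in> A" for i
    using that by blast+
  have uU: "u i \<in> U" if i: "i \<in> A" for i
  proof -
    have "mdist Homeo_plus_metric \<one>\<^bsub>Homeo_plus\<^esub> (u i) < d"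
      unfolding mdist_Homeo_plus_less_iff[OF oneH u(1)[OF i]]
      using u(2)[OF i] by (simp add: one_Homeo_plus abs_minus_commute)
    then show ?thesis
      using d(2) oneH u(1)[OF i] by auto
  qed
  define h where "h i = g i \<otimes>\<^bsub>Homeo_plus\<^esub> u i" for i
  have hH: "h i \<in> Homeo_plus_carrier" if "i \<in> A" for i
    using m_closed g[OF that] u(1)[OF that] by (simp add: h_def carrier_Homeo_plus)
  have "h i c = c" if "i \<in> A" for i
    using mult_Homeo_plus_apply[OF g[OF that] u(1)[OF that], of c] u(3)[OF that] c
    by (simp add: h_def)
  then have "Homeo_plus_topology closure_of generate Homeo_plus (h ` A)
      \<noteq> topspace Homeo_plus_topology"
    using hH by (intro not_dense_if_common_fixed_point[OF _ c]) auto
  moreover have "h i \<in> g i <#\<^bsub>Homeo_plus\<^esub> U" if "i \<in> A" for i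
    using uU[OF that] by (auto simp: h_def l_coset_def)
  ultimately show ?thesis
    by blast
qed

theorem theorem1p4:
  shows "\<not> topological_group.SGP Homeo_plus Homeo_plus_topology"
proof
  assume SGP: "topological_group.SGP Homeo_plus Homeo_plus_topology"
  define g :: "nat \<Rightarrow> real \<Rightarrow> real" where
    "g i = interval_map (if i = 1 then (\<lambda>x. x + 1) else if i = 2 then (\<lambda>x. 2 * x)
      else (\<lambda>x. max x (2 * x)))" for i
  have gH: "g i \<in> Homeo_plus_carrier" for i
    by (simp add: g_def interval_map_in_Homeo_plus_carrier line_homeo_generators)
  have "{1..3::nat} = {1, 2, 3}"
    by auto
  then have gen: "dense_group = generate Homeo_plus (g ` {1..3})"
    by (simp add: dense_group_def g_def)
  obtain U where U: "openin Homeo_plus_topology U" "\<one>\<^bsub>Homeo_plus\<^esub> \<in> U"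
    and dense: "\<forall>h :: nat \<Rightarrow> real \<Rightarrow> real. (\<forall>i\<in>{1..3}. h i \<in> g i <#\<^bsub>Homeo_plus\<^esub> U) \<longrightarrow>
      Homeo_plus_topology closure_of generate Homeo_plus (h ` {1..3})
        = topspace Homeo_plus_topology"
  proof -
    have "\<forall>i\<in>{1..3}. g i \<in> carrier Homeo_plus"
      using gH by (simp add: carrier_Homeo_plus)
    with gen dense_group_dense show thesis
      using SGP[unfolded topological_group.SGP_def[OF topological_group_Homeo_plus]] that by blast
  qed
  show False
    using no_stable_generators[of "{1..3}" g U] gH U dense by blast
qed

end
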